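(* Let $m$ be a positive integer. The roots of the equations $P_m(x)=0$ and $Q_m(x)=0$ are real, simple, negative, contained within the interval $[-4,0]$, and with $\mu_{m\,k}$ and $\nu_{m\,k}$ ($1\le k\le m$) as defined in the context, we have $$\mu_{m\,k}=\phi_{m\,k}-2=2\cos\left(\frac{2\pi k}{2m+1}\right)-2,\qquad \nu_{m\,k}=\psi_{m\,k}-2=2\cos\left(\frac{\pi(2k-1)}{2m+1}\right)-2,$$ so that $$P_m(x)=\prod_{k=1}^m\left(x+2-2\cos\left(\frac{2\pi k}{2m+1}\right)\right)=\frac{1}{\sqrt{x}}\mathcal{L}_{2m+1}(\sqrt{x})=\frac1{\sqrt{x}}\left(\mathcal{F}_{2m+2}(\sqrt{x})+\mathcal{F}_{2m}(\sqrt{x})\right)$$ $$=U_{2m}\left(\sqrt{1+\frac{x}{4}}\right)=S_{2m}\left(\sqrt{x+4}\right)=S_{2m}(2\cos y),\quad\text{with } x=2\cos 2y-2;$$ $$Q_m(x)=\prod_{k=1}^m\left(x+2-2\cos\left(\frac{\pi(2k-1)}{2m}\right)\right)=\mathcal{L}_{2m}(\sqrt{x})=\mathcal{F}_{2m+1}(\sqrt{x})+\mathcal{F}_{2m-1}(\sqrt{x})$$ $$=2T_{2m}\left(\sqrt{1+\frac{x}{4}}\right)=\mathcal{C}_{2m}\left(\sqrt{x+4}\right)=\mathcal{C}_{2m}(2\cos y),\quad\text{with } x=2\cos 2y-2;$$ $$\mathcal{P}_m(x)=\prod_{k=1}^m\left(x+2+2\cos\left(\frac{2\pi k}{2m+1}\right)\right)=\mathcal{F}_{2m+1}(\sqrt{x})$$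 $$=U_{2m}\left(\sqrt{\frac{-x}{4}}\right)=S_{2m}\left(\sqrt{-x}\right)=S_{2m}(2i\cos y),\quad\text{with } x=2\cos 2y+2;$$ $$\mathcal{Q}_m(x)=\frac{1}{\sqrt{x}}\,\mathcal{F}_{2m+2}(\sqrt{x});$$ and $$V_m(x)=P_m(x-2)=\prod_{k=1}^m\left(x-2\cos\left(\frac{2\pi k}{2m+1}\right)\right)$$ $$=U_{2m}\left(\sqrt{\frac{1+x/2}{2}}\right)=S_{2m}\left(\sqrt{x+2}\right)=S_{2m}(2\cos y),\quad\text{with } x=2\cos 2y.$$
   Context: For a positive integer $m$ define the polynomials of degree $m$ $$P_m(x)=\sum_{k=0}^{m}\frac{2m+1}{2k+1}\binom{m+k}{2k}x^{k},\qquad Q_m(x)=\sum_{k=0}^{m}\frac{m}{k}\binom{m+k-1}{2k-1}x^k,$$ $$\mathcal{P}_m(x)=\sum_{k=0}^{m}\binom{m+k}{2k}x^{k},\qquad \mathcal{Q}_m(x)=\sum_{k=0}^{m}\binom{m+k+1}{2k+1}x^k,$$ $$V_m(x)=\sum_{k=0}^m(-1)^{m+\left[\frac{k}{2}+\frac{m}{2}\right]}\binom{\left[\frac{k}{2}+\frac{m}{2}\right]}{k}x^{k},$$ where $[\cdot]$ is the integer part and the $k=0$ term of $Q_m$ is read as $2$, by the limit $\lim_{k\to0}\frac{m}{k}\binom{m+k-1}{2k-1}=2$. The roots of $P_m$, ordered by increasing absolute value, are labelled $\mu_{m\,1},\dots,\mu_{m\,m}$, and the roots of $Q_m$, ordered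 likewise, are labelled $\nu_{m\,1},\dots,\nu_{m\,m}$. Also $\phi_{m\,k}=2\cos\left(\frac{2\pi k}{2m+1}\right)$ and $\psi_{m\,k}=2\cos\left(\frac{(2k-1)\pi}{2m+1}\right)$. $T_n,U_n$ are the Chebyshev polynomials of the first and second kinds: $T_n(\cos\theta)=\cos n\theta$, $U_n(\cos\theta)=\sin((n+1)\theta)/\sin\theta$; $\mathcal{C}_n(x)=2T_n(x/2)$ and $S_n(x)=U_n(x/2)$. The Fibonacci polynomials are given by $\mathcal{F}_1(x)=1$, $\mathcal{F}_2(x)=x$, $\mathcal{F}_{n+1}(x)=x\mathcal{F}_n(x)+\mathcal{F}_{n-1}(x)$; the Lucas polynomials by $\mathcal{L}_1(x)=x$, $\mathcal{L}_2(x)=x^2+2$, $\mathcal{L}_{n+1}(x)=x\mathcal{L}_n(x)+\mathcal{L}_{n-1}(x)$. Here $i^2=-1$.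
   Formalization: Misprints corrected: ψ and ν have denominator 2m instead of 2m+1; the sign exponent in V_m is k+[k/2+m/2] instead of m+[k/2+m/2]; the U_{2m} and S_{2m} forms of 𝒫_m carry a factor (-1)^m; identities with 1/√x are for x≠0. *)

theory Defs
  imports Complex_Main "HOL-Computational_Algebra.Computational_Algebra"
begin

definition poly_P :: "nat \<Rightarrow> complex poly" where
  "poly_P m = (\<Sum>k\<le>m. monom (of_nat (2*m+1) / of_nat (2*k+1) * of_nat ((m+k) choose (2*k))) k)"

definition poly_Q :: "nat \<Rightarrow> complex poly" where
  "poly_Q m = (\<Sum>k\<le>m. monom (if k = 0 then 2
     else of_nat m / of_nat k * of_nat ((m+k-1) choose (2*k-1))) k)"

definition poly_calP :: "nat \<Rightarrow> complex poly" where
  "poly_calP m = (\<Sum>k\<le>m. monom (of_nat ((m+k) choose (2*k))) k)"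

definition poly_calQ :: "nat \<Rightarrow> complex poly" where
  "poly_calQ m = (\<Sum>k\<le>m. monom (of_nat ((m+k+1) choose (2*k+1))) k)"

(* The sign exponent is k + floor(k/2 + m/2). The source prints m + floor(k/2 + m/2);
   that sum equals (-1)^m V_m(-x), and V_m(x) = P_m(x-2) would already fail for m = 1
   (x - 1 against x + 1). *)
definition poly_V :: "nat \<Rightarrow> complex poly" where
  "poly_V m = (\<Sum>k\<le>m. monom ((-1) ^ (k + (k+m) div 2) * of_nat (((k+m) div 2) choose k)) k)"

(* All complex roots, with multiplicity. If the absolute values of the roots were not
   distinct, the list would not be unique and the description would be unspecified. *)
definition roots_by_abs :: "complex poly \<Rightarrow> complex list" where
  "roots_by_abs p = (THE xs. mset xs = proots p \<and> sorted_wrt (\<lambda>a b. cmod a \<le> cmod b) xs)"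

(* Labels run from 1 to m, list positions from 0 to m-1. *)
definition mu_root :: "nat \<Rightarrow> nat \<Rightarrow> complex" where
  "mu_root m k = roots_by_abs (poly_P m) ! (k - 1)"

definition nu_root :: "nat \<Rightarrow> nat \<Rightarrow> complex" where
  "nu_root m k = roots_by_abs (poly_Q m) ! (k - 1)"

definition phi_cos :: "nat \<Rightarrow> nat \<Rightarrow> real" where
  "phi_cos m k = 2 * cos (2 * pi * real k / real (2*m+1))"

(* The source prints the denominator 2m+1 here, but 2m in the factorization of Q_m.
   Only 2m is correct: Q_1(x) = x + 2 has the root -2 = 2 cos(pi/2) - 2. *)
definition psi_cos :: "nat \<Rightarrow> nat \<Rightarrow> real" where
  "psi_cos m k = 2 * cos (pi * (2 * real k - 1) / real (2*m))"

definition cheb_T :: "nat \<Rightarrow> complex poly" where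
  "cheb_T n = (THE p. \<forall>\<theta>::real. poly p (of_real (cos \<theta>)) = of_real (cos (real n * \<theta>)))"

definition cheb_U :: "nat \<Rightarrow> complex poly" where
  "cheb_U n = (THE p. \<forall>\<theta>::real. sin \<theta> \<noteq> 0 \<longrightarrow>
     poly p (of_real (cos \<theta>)) = of_real (sin (real (n+1) * \<theta>) / sin \<theta>))"

definition cheb_C :: "nat \<Rightarrow> complex \<Rightarrow> complex" where
  "cheb_C n x = 2 * poly (cheb_T n) (x / 2)"

definition cheb_S :: "nat \<Rightarrow> complex \<Rightarrow> complex" where
  "cheb_S n x = poly (cheb_U n) (x / 2)"

(* Index 0 extends the recurrences one step below their usual initial values
   F_1 = 1, F_2 = x and L_1 = x, L_2 = x^2 + 2. *)
fun fib_poly :: "nat \<Rightarrow> complex poly" where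
  "fib_poly 0 = 0"
| "fib_poly (Suc 0) = 1"
| "fib_poly (Suc (Suc n)) = [:0, 1:] * fib_poly (Suc n) + fib_poly n"

fun lucas_poly :: "nat \<Rightarrow> complex poly" where
  "lucas_poly 0 = 2"
| "lucas_poly (Suc 0) = [:0, 1:]"
| "lucas_poly (Suc (Suc n)) = [:0, 1:] * lucas_poly (Suc n) + lucas_poly n"

lemma fib_lucas_initial:
  "fib_poly 2 = [:0, 1:]" "lucas_poly 2 = [:0, 1:] ^ 2 + 2"
  by (simp_all add: numeral_2_eq_2)

text \<open>The Chebyshev polynomials exist and are uniquely determined by their values at cosines.\<close>

lemma poly_eq_on_cos:
  fixes p q :: "complex poly"
  assumes "\<And>\<theta>::real. sin \<theta> \<noteq> 0 \<Longrightarrow> poly p (of_real (cos \<theta>)) = poly q (of_real (cos \<theta>))"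
  shows "p = q"
proof (rule ccontr)
  assume "p \<noteq> q"
  then have fin: "finite {x. poly (p - q) x = 0}"
    by (intro poly_roots_finite) simp
  have "complex_of_real ` {-1<..<1} \<subseteq> {x. poly (p - q) x = 0}"
  proof clarify
    fix t :: real assume t: "t \<in> {-1<..<1}"
    then have c: "cos (arccos t) = t" and "0 < arccos t" "arccos t < pi"
      using arccos_lt_bounded[of t] by auto
    then have "sin (arccos t) \<noteq> 0" using sin_gt_zero[of "arccos t"] by simp
    from assms[OF this] show "poly (p - q) (complex_of_real t) = 0" by (simp add: c)
  qed
  then have "finite (complex_of_real ` {-1<..<1})" using fin finite_subset by blast
  then have "finite {-1<..<1::real}" by (rule finite_imageD) (simp add: inj_on_def)
  then show False by (simp add: infinite_Ioo)
qed

lemma cheb_T_cos: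
  "poly (cheb_T n) (of_real (cos \<theta>)) = of_real (cos (real n * \<theta>))"
proof -
  have ex: "\<exists>p::complex poly. \<forall>\<theta>::real. poly p (of_real (cos \<theta>)) = of_real (cos (real n * \<theta>))"
  proof (induction n rule: induct_nat_012)
    case 0
    show ?case by (rule exI[of _ 1]) simp
  next
    case 1
    show ?case by (rule exI[of _ "[:0, 1:]"]) simp
  next
    case (ge2 n)
    then obtain p q :: "complex poly" where
      p: "\<And>\<theta>::real. poly p (of_real (cos \<theta>)) = of_real (cos (real n * \<theta>))" and
      q: "\<And>\<theta>::real. poly q (of_real (cos \<theta>)) = of_real (cos (real (Suc n) * \<theta>))"
      by blast
    have rec: "cos (real (Suc (Suc n)) * \<theta>) = 2 * cos \<theta> * cos (real (Suc n) * \<theta>) - cos (real n * \<theta>)"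
      for \<theta> :: real
      using cos_add[of "real (Suc n) * \<theta>" \<theta>] cos_diff[of "real (Suc n) * \<theta>" \<theta>]
      by (simp add: algebra_simps)
    have "poly ([:0, 2:] * q - p) (of_real (cos \<theta>)) = of_real (cos (real (Suc (Suc n)) * \<theta>))"
      for \<theta> :: real
      unfolding rec by (simp add: p q del: of_nat_Suc)
    then show ?case by blast
  qed
  have "\<exists>!p::complex poly. \<forall>\<theta>::real. poly p (of_real (cos \<theta>)) = of_real (cos (real n * \<theta>))"
    using ex by (rule ex_ex1I) (rule poly_eq_on_cos, simp)
  from theI'[OF this] show ?thesis unfolding cheb_T_def by blast
qed

lemma cheb_U_cos:
  assumes "sin \<theta> \<noteq> 0"
  shows "poly (cheb_U n) (of_real (cos \<theta>)) = of_real (sin (real (n+1) * \<theta>) / sin \<theta>)"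
proof -
  have ex: "\<exists>p::complex poly. \<forall>\<theta>::real. sin \<theta> \<noteq> 0 \<longrightarrow>
      poly p (of_real (cos \<theta>)) = of_real (sin (real (n+1) * \<theta>) / sin \<theta>)"
  proof (induction n rule: induct_nat_012)
    case 0
    show ?case by (rule exI[of _ 1]) simp
  next
    case 1
    show ?case by (rule exI[of _ "[:0, 2:]"]) (simp add: sin_double)
  next
    case (ge2 n)
    then obtain p q :: "complex poly" where
      p: "\<And>\<theta>::real. sin \<theta> \<noteq> 0 \<Longrightarrow> poly p (of_real (cos \<theta>)) = of_real (sin (real (n+1) * \<theta>) / sin \<theta>)" and
      q: "\<And>\<theta>::real. sin \<theta> \<noteq> 0 \<Longrightarrow> poly q (of_real (cos \<theta>)) = of_real (sin (real (Suc n+1) * \<theta>) / sin \<theta>)"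
      by blast
    have rec: "sin (real (Suc (Suc n) + 1) * \<theta>)
        = 2 * cos \<theta> * sin (real (Suc n + 1) * \<theta>) - sin (real (n + 1) * \<theta>)"
      for \<theta> :: real
      using sin_add[of "real (Suc n + 1) * \<theta>" \<theta>] sin_diff[of "real (Suc n + 1) * \<theta>" \<theta>]
      by (simp add: algebra_simps)
    have "poly ([:0, 2:] * q - p) (of_real (cos \<theta>)) = of_real (sin (real (Suc (Suc n) + 1) * \<theta>) / sin \<theta>)"
      if "sin \<theta> \<noteq> 0" for \<theta> :: real
      unfolding rec using p[OF that] q[OF that]
      by (simp add: diff_divide_distrib del: of_nat_Suc of_nat_add)
    then show ?case by blast
  qed
  have "\<exists>!p::complex poly. \<forall>\<theta>::real. sin \<theta> \<noteq> 0 \<longrightarrow>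
      poly p (of_real (cos \<theta>)) = of_real (sin (real (n+1) * \<theta>) / sin \<theta>)"
    using ex by (rule ex_ex1I) (rule poly_eq_on_cos, simp)
  from theI'[OF this] assms show ?thesis unfolding cheb_U_def by blast
qed

end

theory Submission
  imports Defs
begin

text \<open>
  The coefficients of \<open>\<P>\<close> and \<open>\<Q>\<close> (\<open>poly_calP\<close>, \<open>poly_calQ\<close>) are the
  entries of the shallow diagonals of Pascal's triangle, so Pascal's rule gives
  \<open>\<P>\<^bsub>m+1\<^esub> = x \<Q>\<^sub>m + \<P>\<^sub>m\<close> and \<open>\<Q>\<^bsub>m+1\<^esub> = \<P>\<^bsub>m+1\<^esub> + \<Q>\<^sub>m\<close>. This is
  the Fibonacci recurrence read along the odd and the even indices, with \<open>x = s\<^sup>2\<close>; hence the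
  Fibonacci forms (\<open>poly_fib_odd\<close>, \<open>poly_fib_even\<close>). An absorption identity for binomials
  shows \<open>P\<^sub>m = \<Q>\<^sub>m + \<Q>\<^bsub>m-1\<^esub>\<close> and \<open>Q\<^sub>m = \<P>\<^sub>m + \<P>\<^bsub>m-1\<^esub>\<close>, which is the
  relation \<open>L\<^sub>n = F\<^bsub>n+1\<^esub> + F\<^bsub>n-1\<^esub>\<close> and gives the Lucas forms.

  Consequently \<open>P\<close>, \<open>Q\<close> and \<open>\<P>\<close> all satisfy \<open>a\<^bsub>m+2\<^esub> = (x + 2) a\<^bsub>m+1\<^esub> - a\<^sub>m\<close>.
  For \<open>x = 4 t\<^sup>2 - 4\<close> this is the recurrence of the Chebyshev polynomials along even indices,
  so \<open>P\<^sub>m (4 t\<^sup>2 - 4) = U\<^bsub>2m\<^esub> t\<close> and \<open>Q\<^sub>m (4 t\<^sup>2 - 4) = 2 T\<^bsub>2m\<^esub> t\<close>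
  (\<open>poly_P_eq_cheb_U\<close>, \<open>poly_Q_eq_cheb_T\<close>). The same recurrence, after a change of variable,
  identifies \<open>V\<^sub>m x\<close> with \<open>P\<^sub>m (x - 2)\<close> and \<open>\<P>\<^sub>m x\<close> with \<open>(-1)\<^sup>m P\<^sub>m (- x - 4)\<close>, so
  that the products and Chebyshev forms of these two are read off from those of \<open>P\<close>.

  Putting \<open>t = cos y\<close>, where \<open>4 t\<^sup>2 - 4 = 2 cos (2 y) - 2\<close>, the familiar zeros of
  \<open>U\<^bsub>2m\<^esub>\<close> and \<open>T\<^bsub>2m\<^esub>\<close> give \<open>m\<close> roots of \<open>P\<^sub>m\<close> and of \<open>Q\<^sub>m\<close>. They are
  distinct since the cosine decreases on \<open>[0, \<pi>]\<close>, so a monic polynomial of degree \<open>m\<close> has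
  no other roots and no multiple ones. As they are negative and decreasing, their absolute values
  increase, and their natural numbering is the one by absolute value
  (\<open>monic_negative_real_roots\<close>).
\<close>

section \<open>Coefficients and recurrences\<close>

text \<open>
  All the defining sums have coefficient formulas that vanish of themselves beyond the upper limit,
  because the binomials do. So the formulas hold for every index, and identities between
  the polynomials can be compared coefficientwise without attention to degrees.
\<close>

lemma coeff_sum_monom_eq:
  fixes f :: "nat \<Rightarrow> 'a::comm_monoid_add"
  assumes "\<And>k. k > m \<Longrightarrow> f k = 0"
  shows "coeff (\<Sum>k\<le>m. monom (f k) k) k = f k"
  using assms[of k] by (cases "k \<le> m") (auto simp: coeff_sum)

lemma coeff_poly_calP: "coeff (poly_calP m) k = of_nat ((m + k) choose (2 * k))"
  unfolding poly_calP_def by (rule coeff_sum_monom_eq) simp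

lemma coeff_poly_calQ: "coeff (poly_calQ m) k = of_nat ((m + k + 1) choose (2 * k + 1))"
  unfolding poly_calQ_def
  by (rule coeff_sum_monom_eq) (simp add: binomial_eq_0 del: binomial_Suc_Suc)

lemma coeff_poly_P:
  "coeff (poly_P m) k = of_nat (2*m+1) / of_nat (2*k+1) * of_nat ((m+k) choose (2*k))"
  unfolding poly_P_def by (rule coeff_sum_monom_eq) simp

lemma coeff_poly_Q:
  "coeff (poly_Q m) k = (if k = 0 then 2
     else of_nat m / of_nat k * of_nat ((m+k-1) choose (2*k-1)))"
  unfolding poly_Q_def by (rule coeff_sum_monom_eq) (simp, arith)

lemma coeff_poly_V:
  "coeff (poly_V m) k = (-1) ^ (k + (k+m) div 2) * of_nat (((k+m) div 2) choose k)"
  unfolding poly_V_def by (rule coeff_sum_monom_eq) simp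

lemma poly_calP_Suc: "poly_calP (Suc m) = pCons 0 (poly_calQ m) + poly_calP m"
proof (rule poly_eqI)
  fix k show "coeff (poly_calP (Suc m)) k = coeff (pCons 0 (poly_calQ m) + poly_calP m) k"
    by (cases k) (simp_all add: coeff_poly_calP coeff_poly_calQ del: of_nat_Suc)
qed

lemma poly_calQ_Suc: "poly_calQ (Suc m) = poly_calP (Suc m) + poly_calQ m"
  by (rule poly_eqI) (simp add: coeff_poly_calP coeff_poly_calQ)

text \<open>
  The rational factors in the coefficients of \<open>P\<close> and \<open>Q\<close> come from this identity: by
  absorption, \<open>n choose (k + 1)\<close> is \<open>(n - k) / (k + 1)\<close> times \<open>n choose k\<close>.
\<close>

lemma choose_plus_twice_choose_Suc:
  "(of_nat (n choose k) + 2 * of_nat (n choose Suc k) :: complex)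
     = (2 * of_nat n + 1 - of_nat k) / of_nat (Suc k) * of_nat (n choose k)"
proof -
  have "of_nat (Suc k) * (of_nat (n choose Suc k) :: complex)
      = (of_nat n - of_nat k) * of_nat (n choose k)"
  proof (cases "k \<le> n")
    case True
    have "Suc k * (n choose Suc k) = (n - k) * (n choose k)"
      by (metis binomial_absorb_comp binomial_absorption)
    then show ?thesis using True by (metis of_nat_diff of_nat_mult)
  qed (simp add: binomial_eq_0)
  then have "of_nat (Suc k) * (of_nat (n choose k) + 2 * of_nat (n choose Suc k) :: complex)
      = (of_nat (Suc k) + 2 * (of_nat n - of_nat k)) * of_nat (n choose k)"
    by (simp only: distrib_left distrib_right mult.left_commute[of _ 2] mult.assoc)
  also have "\<dots> = (2 * of_nat n + 1 - of_nat k) * of_nat (n choose k)"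
    by (simp add: algebra_simps)
  finally show ?thesis
    by (simp add: nonzero_eq_divide_eq mult.commute del: of_nat_Suc)
qed

text \<open>
  By Pascal's rule the two binomials on the right are \<open>(n choose 2k) + (n choose (2k+1))\<close> and
  \<open>n choose (2k+1)\<close> for \<open>n = m + 1 + k\<close>, the combination just evaluated. For \<open>Q\<close>, where the
  constant term 2 is the sum of two constant terms 1, the same happens at \<open>2k - 1\<close>.
\<close>

lemma poly_P_Suc: "poly_P (Suc m) = poly_calQ (Suc m) + poly_calQ m"
proof (rule poly_eqI)
  fix k show "coeff (poly_P (Suc m)) k = coeff (poly_calQ (Suc m) + poly_calQ m) k"
    using choose_plus_twice_choose_Suc[of "Suc m + k" "2 * k"]
    by (simp add: coeff_poly_P coeff_poly_calQ add_ac)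
qed

lemma poly_Q_Suc: "poly_Q (Suc m) = poly_calP (Suc m) + poly_calP m"
proof (rule poly_eqI)
  fix k
  show "coeff (poly_Q (Suc m)) k = coeff (poly_calP (Suc m) + poly_calP m) k"
  proof (cases k)
    case (Suc j)
    let ?n = "Suc m + j" and ?i = "2 * j + 1"
    have "(2 * of_nat ?n + 1 - of_nat ?i :: complex) / of_nat (Suc ?i)
        = (2 * of_nat (Suc m)) / (2 * of_nat (Suc j))"
      by simp
    also have "\<dots> = of_nat (Suc m) / of_nat (Suc j)"
      by (rule mult_divide_mult_cancel_left) simp
    finally have "of_nat (Suc m) / of_nat (Suc j) * of_nat (?n choose ?i)
        = (of_nat (?n choose ?i) + 2 * of_nat (?n choose Suc ?i) :: complex)"
      by (simp only: choose_plus_twice_choose_Suc)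
    then show ?thesis
      by (simp add: Suc coeff_poly_Q coeff_poly_calP del: of_nat_Suc)
  qed (simp add: coeff_poly_Q coeff_poly_calP)
qed

lemma poly_zero_index:
  "poly_calP 0 = 1" "poly_calQ 0 = 1" "poly_P 0 = 1" "poly_Q 0 = 2" "poly_V 0 = 1"
  by (simp_all add: poly_calP_def poly_calQ_def poly_P_def poly_Q_def poly_V_def numeral_poly monom_0)

text \<open>
  Eliminating \<open>poly_calQ\<close> from the two first-order recurrences gives the common three-term
  recurrence. It also holds when \<open>m = 0\<close> for \<open>P\<close> and \<open>Q\<close>, which involves the members of
  index 0 that are not sums of two neighbours.
\<close>

lemma poly_calP_rec:
  "poly (poly_calP (Suc (Suc m))) x
     = (x + 2) * poly (poly_calP (Suc m)) x - poly (poly_calP m) x"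
  by (simp add: poly_calP_Suc[of "Suc m"] poly_calQ_Suc poly_calP_Suc[of m] algebra_simps)

lemma poly_P_rec:
  "poly (poly_P (Suc (Suc m))) x = (x + 2) * poly (poly_P (Suc m)) x - poly (poly_P m) x"
  by (cases m) (simp_all add: poly_P_Suc poly_calP_Suc poly_calQ_Suc poly_zero_index algebra_simps)

lemma poly_Q_rec:
  "poly (poly_Q (Suc (Suc m))) x = (x + 2) * poly (poly_Q (Suc m)) x - poly (poly_Q m) x"
  by (cases m) (simp_all add: poly_Q_Suc poly_calP_Suc poly_calQ_Suc poly_zero_index algebra_simps)

text \<open>
  With \<open>j = (k + m) div 2\<close>, the coefficients at \<open>k\<close> of index \<open>m + 2\<close> and \<open>m\<close>, and the one at
  \<open>k - 1\<close> of index \<open>m + 1\<close>, involve only rows \<open>j + 1\<close> and \<open>j\<close> of Pascal's triangle, so this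
  is again Pascal's rule.
\<close>

lemma poly_V_rec: "poly_V (Suc (Suc m)) = pCons 0 (poly_V (Suc m)) - poly_V m"
proof (rule poly_eqI)
  fix k show "coeff (poly_V (Suc (Suc m))) k = coeff (pCons 0 (poly_V (Suc m)) - poly_V m) k"
    by (cases k) (simp_all add: coeff_poly_V algebra_simps)
qed

lemma poly_V_eq_P: "poly (poly_V m) x = poly (poly_P m) (x - 2)"
proof (induction m rule: induct_nat_012)
  case 1
  show ?case by (simp add: poly_V_def poly_P_def poly_monom numeral_2_eq_2)
next
  case (ge2 m)
  then show ?case by (simp add: poly_V_rec poly_P_rec)
qed (simp add: poly_zero_index)

text \<open>
  The reflection \<open>x \<mapsto> - x - 4\<close> negates the factor \<open>x + 2\<close> of the recurrence, and the sign
  \<open>(-1)\<^sup>m\<close> compensates for that.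
\<close>

lemma poly_calP_eq_P: "poly (poly_calP m) x = (-1) ^ m * poly (poly_P m) (- x - 4)"
proof (induction m rule: induct_nat_012)
  case 1
  show ?case by (simp add: poly_calP_def poly_P_def poly_monom numeral_2_eq_2)
next
  case (ge2 m)
  then show ?case by (simp add: poly_calP_rec poly_P_rec algebra_simps)
qed (simp add: poly_zero_index)

section \<open>Fibonacci, Lucas and Chebyshev polynomials\<close>

lemma poly_fib_odd: "poly (fib_poly (2*m+1)) s = poly (poly_calP m) (s\<^sup>2)"
  and poly_fib_even: "poly (fib_poly (2*m+2)) s = s * poly (poly_calQ m) (s\<^sup>2)"
proof (induction m)
  case 0
  show "poly (fib_poly (2*0+1)) s = poly (poly_calP 0) (s\<^sup>2)"
    "poly (fib_poly (2*0+2)) s = s * poly (poly_calQ 0) (s\<^sup>2)"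
    by (simp_all add: poly_zero_index numeral_2_eq_2)
next
  case (Suc m)
  have odd: "poly (fib_poly (2 * Suc m + 1)) s = poly (poly_calP (Suc m)) (s\<^sup>2)"
    using Suc by (simp add: poly_calP_Suc power2_eq_square)
  then show "poly (fib_poly (2 * Suc m + 1)) s = poly (poly_calP (Suc m)) (s\<^sup>2)" .
  show "poly (fib_poly (2 * Suc m + 2)) s = s * poly (poly_calQ (Suc m)) (s\<^sup>2)"
  proof -
    have "fib_poly (2 * Suc m + 2) = [:0, 1:] * fib_poly (2 * Suc m + 1) + fib_poly (2 * m + 2)"
      by simp
    then show ?thesis
      using Suc(2) odd by (simp add: poly_calQ_Suc distrib_left del: fib_poly.simps)
  qed
qed

lemma lucas_poly_eq_fib: "lucas_poly (Suc n) = fib_poly (Suc (Suc n)) + fib_poly n"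
  by (induction n rule: induct_nat_012) (simp_all add: algebra_simps numeral_poly)

lemma cheb_T_0: "cheb_T 0 = 1" and cheb_T_1: "cheb_T (Suc 0) = [:0, 1:]"
  by (rule poly_eq_on_cos; simp add: cheb_T_cos)+

lemma cheb_T_rec: "cheb_T (Suc (Suc n)) = [:0, 2:] * cheb_T (Suc n) - cheb_T n"
proof (rule poly_eq_on_cos)
  fix \<theta> :: real
  have "cos (real (Suc (Suc n)) * \<theta>) = 2 * cos \<theta> * cos (real (Suc n) * \<theta>) - cos (real n * \<theta>)"
    using cos_add[of "real (Suc n) * \<theta>" \<theta>] cos_diff[of "real (Suc n) * \<theta>" \<theta>]
    by (simp add: algebra_simps)
  then show "poly (cheb_T (Suc (Suc n))) (of_real (cos \<theta>))
      = poly ([:0, 2:] * cheb_T (Suc n) - cheb_T n) (of_real (cos \<theta>))"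
    by (simp add: cheb_T_cos del: of_nat_Suc)
qed

lemma cheb_U_0: "cheb_U 0 = 1" and cheb_U_1: "cheb_U (Suc 0) = [:0, 2:]"
  by (rule poly_eq_on_cos; simp add: cheb_U_cos sin_double)+

lemma cheb_U_rec: "cheb_U (Suc (Suc n)) = [:0, 2:] * cheb_U (Suc n) - cheb_U n"
proof (rule poly_eq_on_cos)
  fix \<theta> :: real
  assume nz: "sin \<theta> \<noteq> 0"
  have "sin (real (Suc (Suc n) + 1) * \<theta>)
      = 2 * cos \<theta> * sin (real (Suc n + 1) * \<theta>) - sin (real (n + 1) * \<theta>)"
    using sin_add[of "real (Suc n + 1) * \<theta>" \<theta>] sin_diff[of "real (Suc n + 1) * \<theta>" \<theta>]
    by (simp add: algebra_simps)
  then show "poly (cheb_U (Suc (Suc n))) (of_real (cos \<theta>))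
      = poly ([:0, 2:] * cheb_U (Suc n) - cheb_U n) (of_real (cos \<theta>))"
    by (simp add: cheb_U_cos nz diff_divide_distrib del: of_nat_Suc of_nat_add)
qed

text \<open>
  A Chebyshev-type recurrence \<open>u\<^bsub>n+2\<^esub> = 2 t u\<^bsub>n+1\<^esub> - u\<^sub>n\<close> has characteristic roots
  \<open>z, 1 / z\<close> with \<open>z + 1 / z = 2 t\<close>; every second member satisfies the recurrence for their
  squares, whose sum is \<open>4 t\<^sup>2 - 2\<close>.
\<close>

lemma even_subsequence_rec:
  fixes u :: "nat \<Rightarrow> 'a::comm_ring_1"
  assumes "\<And>n. u (Suc (Suc n)) = 2 * t * u (Suc n) - u n"
  shows "u (2 * Suc (Suc m)) = (4 * t\<^sup>2 - 2) * u (2 * Suc m) - u (2 * m)"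
proof -
  have "u (2 * Suc (Suc m)) = 2 * t * (2 * t * u (2 * Suc m) - u (Suc (2 * m))) - u (2 * Suc m)"
    using assms[of "2 * m + 2"] assms[of "2 * m + 1"] by simp
  also have "\<dots> = (4 * t\<^sup>2 - 1) * u (2 * Suc m) - 2 * t * u (Suc (2 * m))"
    by (simp add: algebra_simps power2_eq_square)
  also have "2 * t * u (Suc (2 * m)) = u (2 * Suc m) + u (2 * m)"
    using assms[of "2 * m"] by simp
  finally show ?thesis by (simp add: algebra_simps)
qed

text \<open>
  The substitution \<open>x = 4 t\<^sup>2 - 4\<close> is the one for which \<open>x + 2 = 4 t\<^sup>2 - 2\<close>.
\<close>

lemma poly_P_eq_cheb_U: "poly (poly_P m) (4 * t\<^sup>2 - 4) = poly (cheb_U (2*m)) t"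
proof (induction m rule: induct_nat_012)
  case 1
  show ?case
    by (simp add: poly_P_def poly_monom numeral_2_eq_2 cheb_U_rec cheb_U_1 cheb_U_0)
next
  case (ge2 m)
  have "poly (cheb_U (2 * Suc (Suc m))) t
      = (4 * t\<^sup>2 - 2) * poly (cheb_U (2 * Suc m)) t - poly (cheb_U (2 * m)) t"
    by (rule even_subsequence_rec) (simp add: cheb_U_rec)
  with ge2 show ?case by (simp only: poly_P_rec) (simp add: algebra_simps)
qed (simp add: poly_zero_index cheb_U_0)

lemma poly_Q_eq_cheb_T: "poly (poly_Q m) (4 * t\<^sup>2 - 4) = 2 * poly (cheb_T (2*m)) t"
proof (induction m rule: induct_nat_012)
  case 1
  show ?case
    by (simp add: poly_Q_def poly_monom numeral_2_eq_2 cheb_T_rec cheb_T_1 cheb_T_0)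
next
  case (ge2 m)
  have "poly (cheb_T (2 * Suc (Suc m))) t
      = (4 * t\<^sup>2 - 2) * poly (cheb_T (2 * Suc m)) t - poly (cheb_T (2 * m)) t"
    by (rule even_subsequence_rec) (simp add: cheb_T_rec)
  with ge2 show ?case by (simp only: poly_Q_rec) (simp add: algebra_simps)
qed (simp add: poly_zero_index cheb_T_0)

section \<open>The roots\<close>

lemma poly_P_root:
  assumes "k \<in> {1..m}"
  shows "poly (poly_P m) (of_real (phi_cos m k - 2)) = 0"
proof -
  \<comment> \<open>half of the angle in the claimed root, since it is the double angle that occurs there\<close>
  define y where "y = pi * real k / real (2*m+1)"
  have y: "0 < y" "y < pi"
    using assms mult_strict_left_mono[of "real k / real (2*m+1)" 1 pi] by (auto simp: y_def)
  then have sy: "sin y \<noteq> 0" using sin_gt_zero by force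
  have "phi_cos m k - 2 = 4 * (cos y)\<^sup>2 - 4"
    using cos_double_cos[of y] by (simp add: phi_cos_def y_def mult_ac)
  then have "complex_of_real (phi_cos m k - 2) = 4 * (of_real (cos y))\<^sup>2 - 4"
    by (simp only: of_real_diff of_real_mult of_real_power of_real_numeral)
  then have "poly (poly_P m) (of_real (phi_cos m k - 2))
      = poly (cheb_U (2*m)) (of_real (cos y))"
    by (simp only: poly_P_eq_cheb_U)
  moreover have "real (2*m+1) * y = real k * pi"
    unfolding y_def by (simp add: field_simps del: of_nat_add of_nat_mult)
  ultimately show ?thesis
    using cheb_U_cos[OF sy, of "2*m"] by (simp del: of_nat_add of_nat_mult)
qed

lemma poly_Q_root:
  assumes "k \<in> {1..m}"
  shows "poly (poly_Q m) (of_real (psi_cos m k - 2)) = 0"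
proof -
  define y where "y = pi * (2 * real k - 1) / real (4*m)"
  have "pi * (2 * real k - 1) / real (2*m) = 2 * y"
    by (simp add: y_def)
  then have "psi_cos m k - 2 = 4 * (cos y)\<^sup>2 - 4"
    unfolding psi_cos_def by (simp only: cos_double_cos) simp
  then have "complex_of_real (psi_cos m k - 2) = 4 * (of_real (cos y))\<^sup>2 - 4"
    by (simp only: of_real_diff of_real_mult of_real_power of_real_numeral)
  then have "poly (poly_Q m) (of_real (psi_cos m k - 2))
      = 2 * poly (cheb_T (2*m)) (of_real (cos y))"
    by (simp only: poly_Q_eq_cheb_T)
  moreover have "real (2*m) * y = real (2*k-1) * (pi/2)"
    using assms unfolding y_def by (simp add: field_simps of_nat_diff)
  moreover have "cos (real (2*k-1) * (pi/2)) = 0"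
    using assms by (subst cos_zero_iff) (auto intro!: exI[of _ "2*k-1"])
  ultimately show ?thesis
    using cheb_T_cos[of "2*m" y] by (simp del: of_nat_add of_nat_mult)
qed

text \<open>
  Angles are written as multiples of \<open>\<pi>\<close> so that the monotonicity of the cosine reduces to
  comparing fractions.
\<close>

lemma cos_pi_mult_less:
  assumes "0 \<le> a" "a < b" "b \<le> 1"
  shows "cos (pi * b) < cos (pi * a)"
  using assms by (intro cos_monotone_0_pi) (simp_all add: mult_left_le)

lemma phi_cos_strict_antimono:
  assumes "j < k" "k \<le> m"
  shows "phi_cos m k < phi_cos m j"
proof -
  have "0 \<le> 2 * real j / real (2*m+1)" "2 * real j / real (2*m+1) < 2 * real k / real (2*m+1)"
    "2 * real k / real (2*m+1) \<le> 1"
    using assms by (auto intro: divide_strict_right_mono)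
  from cos_pi_mult_less[OF this] show ?thesis by (simp add: phi_cos_def mult_ac)
qed

lemma psi_cos_strict_antimono:
  assumes "1 \<le> j" "j < k" "k \<le> m"
  shows "psi_cos m k < psi_cos m j"
proof -
  have "0 \<le> (2 * real j - 1) / real (2*m)"
    "(2 * real j - 1) / real (2*m) < (2 * real k - 1) / real (2*m)"
    "(2 * real k - 1) / real (2*m) \<le> 1"
    using assms by (auto intro: divide_strict_right_mono)
  from cos_pi_mult_less[OF this] show ?thesis by (simp add: psi_cos_def)
qed

lemma phi_cos_minus_2_range:
  assumes "k \<in> {1..m}"
  shows "- 4 \<le> phi_cos m k - 2 \<and> phi_cos m k - 2 < 0"
proof
  show "- 4 \<le> phi_cos m k - 2"
    using cos_ge_minus_one[of "2 * pi * real k / real (2*m+1)"] unfolding phi_cos_def by linarith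
  show "phi_cos m k - 2 < 0"
    using phi_cos_strict_antimono[of 0 k m] assms by (simp add: phi_cos_def)
qed

lemma psi_cos_minus_2_range:
  assumes "k \<in> {1..m}"
  shows "- 4 \<le> psi_cos m k - 2 \<and> psi_cos m k - 2 < 0"
proof
  show "- 4 \<le> psi_cos m k - 2"
    using cos_ge_minus_one[of "pi * (2 * real k - 1) / real (2*m)"] unfolding psi_cos_def by linarith
  have "0 < (2 * real k - 1) / real (2*m)" "(2 * real k - 1) / real (2*m) \<le> 1"
    using assms by auto
  from cos_pi_mult_less[OF order_refl this] show "psi_cos m k - 2 < 0"
    by (simp add: psi_cos_def)
qed

section \<open>Monic polynomials with known distinct roots\<close>

lemma monic_eq_prod_roots:
  fixes p :: "'a::field poly"
  assumes "degree p = card A" "lead_coeff p = 1" "finite A" "inj_on r A"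
    and "\<And>k. k \<in> A \<Longrightarrow> poly p (r k) = 0"
  shows "p = (\<Prod>k\<in>A. [:- r k, 1:])"
proof (rule poly_eqI_degree_lead_coeff[where n = "card A" and A = "r ` A"])
  have deg: "degree (\<Prod>k\<in>A. [:- r k, 1:]) = card A"
    by (subst degree_prod_eq_sum_degree) auto
  then show "degree (\<Prod>k\<in>A. [:- r k, 1:]) \<le> card A" by simp
  have "lead_coeff (\<Prod>k\<in>A. [:- r k, 1:]) = 1"
    by (simp add: lead_coeff_prod)
  then show "coeff p (card A) = coeff (\<Prod>k\<in>A. [:- r k, 1:]) (card A)"
    using assms(1,2) deg by simp
  show "poly p z = poly (\<Prod>k\<in>A. [:- r k, 1:]) z" if "z \<in> r ` A" for z
    using that assms(3,5) by (auto simp: poly_prod prod_zero_iff)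
qed (use assms in \<open>auto simp: card_image\<close>)

lemma proots_prod_linear:
  fixes r :: "'b \<Rightarrow> 'a::idom"
  assumes "finite A"
  shows "proots (\<Prod>k\<in>A. [:- r k, 1:]) = image_mset r (mset_set A)"
  using assms by (subst proots_prod) (auto simp: sum_unfold_sum_mset)

lemma order_prod_linear:
  fixes r :: "'b \<Rightarrow> 'a::idom"
  assumes "finite A" "inj_on r A" "p = (\<Prod>k\<in>A. [:- r k, 1:])" "poly p z = 0"
  shows "order z p = 1"
proof -
  obtain k where k: "k \<in> A" "z = r k"
    using assms by (auto simp: poly_prod prod_zero_iff)
  have "p \<noteq> 0" using assms(1) by (simp add: assms(3))
  then have "order z p = count (proots p) z" by simp
  also have "proots p = mset_set (r ` A)"
    using assms by (simp add: proots_prod_linear image_mset_mset_set)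
  also have "count (mset_set (r ` A)) z = 1" using assms(1) k by simp
  finally show ?thesis .
qed

text \<open>
  The sorted list of the roots is unique because the absolute values are pairwise distinct; this is
  what makes the description in \<open>roots_by_abs\<close> definite.
\<close>

lemma roots_by_abs_prod_linear:
  assumes mono: "\<And>j k. 1 \<le> j \<Longrightarrow> j < k \<Longrightarrow> k \<le> m \<Longrightarrow> cmod (r j) < cmod (r k)"
  shows "roots_by_abs (\<Prod>k=1..m. [:- r k, 1:]) = map r [1..<Suc m]"
proof -
  let ?xs = "map r [1..<Suc m]" and ?p = "\<Prod>k=1..m. [:- r k, 1:]"
  have roots: "proots ?p = mset ?xs"
    by (subst proots_prod_linear) (simp_all add: atLeastLessThanSuc_atLeastAtMost del: upt_Suc)
  have strict: "sorted_wrt (<) (map cmod ?xs)"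
    unfolding sorted_wrt_iff_nth_less using mono by (simp del: upt_Suc)
  then have sd: "sorted (map cmod ?xs)" "distinct (map cmod ?xs)"
    using strict_sorted_iff by blast+
  show ?thesis unfolding roots_by_abs_def
  proof (rule the_equality)
    show "mset ?xs = proots ?p \<and> sorted_wrt (\<lambda>a b. cmod a \<le> cmod b) ?xs"
      using roots sd(1) by (simp add: sorted_wrt_map del: upt_Suc)
  next
    fix ys assume ys: "mset ys = proots ?p \<and> sorted_wrt (\<lambda>a b. cmod a \<le> cmod b) ys"
    then have eq: "mset ys = mset ?xs" using roots by simp
    show "ys = ?xs"
    proof (rule map_sorted_distinct_set_unique[where f = cmod])
      show "set ys = set ?xs" by (rule mset_eq_setD[OF eq])
      then show "inj_on cmod (set ys \<union> set ?xs)" 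
        using sd(2) by (simp add: distinct_map inj_on_imageI del: upt_Suc)
      show "sorted (map cmod ys)" using ys by (simp add: sorted_wrt_map)
      have "mset (map cmod ys) = mset (map cmod ?xs)" using eq by (metis mset_map)
      then show "distinct (map cmod ys)" using sd(2) mset_eq_imp_distinct_iff by blast
    qed (use sd in simp_all)
  qed
qed

text \<open>
  For negative reals, decreasing means increasing in absolute value, so the numbering \<open>r\<close> already
  is the ordering of the roots. The subtraction of 1 translates labels that start at 1 into list
  positions.
\<close>

lemma monic_negative_real_roots:
  fixes p :: "complex poly" and r :: "nat \<Rightarrow> real"
  assumes "degree p = m" "lead_coeff p = 1"
    and root: "\<forall>k\<in>{1..m}. poly p (of_real (r k)) = 0"
    and range: "\<forall>k\<in>{1..m}. - 4 \<le> r k \<and> r k < 0"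
    and anti: "strict_antimono_on {1..m} r"
  shows "poly p x = (\<Prod>k=1..m. x - of_real (r k))"
    and "\<And>k. k \<in> {1..m} \<Longrightarrow> roots_by_abs p ! (k - 1) = of_real (r k)"
    and "poly p z = 0 \<Longrightarrow> z \<in> \<real> \<and> order z p = 1 \<and> Re z < 0 \<and> Re z \<in> {-4..0}"
proof -
  let ?r = "\<lambda>k. complex_of_real (r k)"
  have mono: "r k < r j" if "1 \<le> j" "j < k" "k \<le> m" for j k
    using monotone_onD[OF anti, of j k] that by simp
  have inj: "inj_on ?r {1..m}"
    by (rule linorder_inj_onI') (use mono in force)
  have p: "p = (\<Prod>k=1..m. [:- ?r k, 1:])"
    by (rule monic_eq_prod_roots) (use assms(1,2) root inj in auto)
  show "poly p x = (\<Prod>k=1..m. x - of_real (r k))"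
    by (subst p) (simp add: poly_prod)
  have "roots_by_abs p = map ?r [1..<Suc m]"
    unfolding p
  proof (rule roots_by_abs_prod_linear)
    fix j k assume "1 \<le> j" "j < k" "k \<le> m"
    then show "cmod (?r j) < cmod (?r k)"
      using mono[of j k] bspec[OF range, of j] bspec[OF range, of k] by (simp add: abs_if)
  qed
  then show "roots_by_abs p ! (k - 1) = of_real (r k)" if "k \<in> {1..m}" for k
    using that by (auto simp del: upt_Suc)
  assume z: "poly p z = 0"
  have "poly (\<Prod>k=1..m. [:- ?r k, 1:]) z = 0" using z p by metis
  then obtain k where "k \<in> {1..m}" "z = ?r k"
    by (auto simp: poly_prod)
  moreover have "order z p = 1"
    by (rule order_prod_linear[OF _ inj p z]) simp
  ultimately show "z \<in> \<real> \<and> order z p = 1 \<and> Re z < 0 \<and> Re z \<in> {-4..0}"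
    using bspec[OF range, of k] by simp
qed

section \<open>Factorizations and Chebyshev forms\<close>

lemma degree_poly_P: "degree (poly_P m) = m" and lead_coeff_poly_P: "lead_coeff (poly_P m) = 1"
proof -
  have "coeff (poly_P m) m = 1"
    by (simp add: coeff_poly_P flip: mult_2) (metis of_nat_Suc of_nat_mult of_nat_numeral of_nat_neq_0)
  moreover from this show "degree (poly_P m) = m"
    by (intro antisym degree_le le_degree) (auto simp: coeff_poly_P binomial_eq_0)
  ultimately show "lead_coeff (poly_P m) = 1" by simp
qed

lemma degree_poly_Q: "degree (poly_Q m) = m" 
  and lead_coeff_poly_Q: "lead_coeff (poly_Q m) = 1" if "m \<ge> 1"
proof -
  have "coeff (poly_Q m) m = 1"
    using that by (simp add: coeff_poly_Q flip: mult_2)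
  moreover from this show "degree (poly_Q m) = m"
    by (intro antisym degree_le le_degree) (auto simp: coeff_poly_Q binomial_eq_0)
  ultimately show "lead_coeff (poly_Q m) = 1" by simp
qed


theorem theorem1:
  fixes m :: nat
  assumes "m \<ge> 1"
  shows
    "(\<forall>z. poly (poly_P m) z = 0 \<longrightarrow>
        z \<in> \<real> \<and> order z (poly_P m) = 1 \<and> Re z < 0 \<and> Re z \<in> {-4..0}) \<and>
     (\<forall>z. poly (poly_Q m) z = 0 \<longrightarrow>
        z \<in> \<real> \<and> order z (poly_Q m) = 1 \<and> Re z < 0 \<and> Re z \<in> {-4..0}) \<and>
     (\<forall>k\<in>{1..m}.
        mu_root m k = of_real (phi_cos m k - 2) \<and>
        mu_root m k = of_real (2 * cos (2 * pi * real k / real (2*m+1)) - 2)) \<and>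
     (\<forall>k\<in>{1..m}.
        nu_root m k = of_real (psi_cos m k - 2) \<and>
        nu_root m k = of_real (2 * cos (pi * (2 * real k - 1) / real (2*m)) - 2)) \<and>
     (\<forall>x::complex.
        poly (poly_P m) x = (\<Prod>k=1..m. x + 2 - of_real (2 * cos (2 * pi * real k / real (2*m+1)))) \<and>
        (x \<noteq> 0 \<longrightarrow>
          poly (poly_P m) x = 1 / csqrt x * poly (lucas_poly (2*m+1)) (csqrt x) \<and>
          poly (poly_P m) x =
            1 / csqrt x * (poly (fib_poly (2*m+2)) (csqrt x) + poly (fib_poly (2*m)) (csqrt x))) \<and>
        poly (poly_P m) x = poly (cheb_U (2*m)) (csqrt (1 + x/4)) \<and>
        poly (poly_P m) x = cheb_S (2*m) (csqrt (x + 4)) \<and>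
        (\<forall>y::complex. x = 2 * cos (2*y) - 2 \<longrightarrow>
          poly (poly_P m) x = cheb_S (2*m) (2 * cos y))) \<and>
     (\<forall>x::complex.
        poly (poly_Q m) x = (\<Prod>k=1..m. x + 2 - of_real (2 * cos (pi * (2 * real k - 1) / real (2*m)))) \<and>
        poly (poly_Q m) x = poly (lucas_poly (2*m)) (csqrt x) \<and>
        poly (poly_Q m) x = poly (fib_poly (2*m+1)) (csqrt x) + poly (fib_poly (2*m-1)) (csqrt x) \<and>
        poly (poly_Q m) x = 2 * poly (cheb_T (2*m)) (csqrt (1 + x/4)) \<and>
        poly (poly_Q m) x = cheb_C (2*m) (csqrt (x + 4)) \<and>
        (\<forall>y::complex. x = 2 * cos (2*y) - 2 \<longrightarrow>
          poly (poly_Q m) x = cheb_C (2*m) (2 * cos y))) \<and>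
     (\<forall>x::complex.
        poly (poly_calP m) x = (\<Prod>k=1..m. x + 2 + of_real (2 * cos (2 * pi * real k / real (2*m+1)))) \<and>
        poly (poly_calP m) x = poly (fib_poly (2*m+1)) (csqrt x) \<and>
        poly (poly_calP m) x = (-1)^m * poly (cheb_U (2*m)) (csqrt (- x / 4)) \<and>
        poly (poly_calP m) x = (-1)^m * cheb_S (2*m) (csqrt (- x)) \<and>
        (\<forall>y::complex. x = 2 * cos (2*y) + 2 \<longrightarrow>
          poly (poly_calP m) x = (-1)^m * cheb_S (2*m) (2 * \<i> * cos y))) \<and>
     (\<forall>x::complex. x \<noteq> 0 \<longrightarrow>
        poly (poly_calQ m) x = 1 / csqrt x * poly (fib_poly (2*m+2)) (csqrt x)) \<and>
     (\<forall>x::complex.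
        poly (poly_V m) x = poly (poly_P m) (x - 2) \<and>
        poly (poly_V m) x = (\<Prod>k=1..m. x - of_real (2 * cos (2 * pi * real k / real (2*m+1)))) \<and>
        poly (poly_V m) x = poly (cheb_U (2*m)) (csqrt ((1 + x/2) / 2)) \<and>
        poly (poly_V m) x = cheb_S (2*m) (csqrt (x + 2)) \<and>
        (\<forall>y::complex. x = 2 * cos (2*y) \<longrightarrow>
          poly (poly_V m) x = cheb_S (2*m) (2 * cos y)))"
proof -
  \<comment> \<open>P and Q are sums of neighbouring members of the Fibonacci families only from index 1 on.\<close>
  obtain n where m: "m = Suc n" using assms by (cases m) auto
  have "\<forall>k\<in>{1..m}. poly (poly_P m) (of_real (phi_cos m k - 2)) = 0"
    "\<forall>k\<in>{1..m}. - 4 \<le> phi_cos m k - 2 \<and> phi_cos m k - 2 < 0"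
    "strict_antimono_on {1..m} (\<lambda>k. phi_cos m k - 2)"
    by (use poly_P_root phi_cos_minus_2_range phi_cos_strict_antimono in
        \<open>auto intro!: monotone_onI simp del: of_real_diff\<close>)
  note P = monic_negative_real_roots[OF degree_poly_P lead_coeff_poly_P this]
  have "\<forall>k\<in>{1..m}. poly (poly_Q m) (of_real (psi_cos m k - 2)) = 0"
    "\<forall>k\<in>{1..m}. - 4 \<le> psi_cos m k - 2 \<and> psi_cos m k - 2 < 0"
    "strict_antimono_on {1..m} (\<lambda>k. psi_cos m k - 2)"
    by (use poly_Q_root psi_cos_minus_2_range psi_cos_strict_antimono in
        \<open>auto intro!: monotone_onI simp del: of_real_diff\<close>)
  note Q = monic_negative_real_roots[OF degree_poly_Q[OF assms] lead_coeff_poly_Q[OF assms] this]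
  \<comment> \<open>Every Chebyshev form in the theorem arises from one of the next four facts by choosing
    a square root t of a linear function of x; the sign of the root is immaterial.\<close>
  have PU: "poly (poly_P m) x = poly (cheb_U (2*m)) t" if "x = 4 * t\<^sup>2 - 4" for x t
    using poly_P_eq_cheb_U[of m t] that by simp
  have QT: "poly (poly_Q m) x = 2 * poly (cheb_T (2*m)) t" if "x = 4 * t\<^sup>2 - 4" for x t
    using poly_Q_eq_cheb_T[of m t] that by simp
  have calPU: "poly (poly_calP m) x = (-1) ^ m * poly (cheb_U (2*m)) t" if "x = - (4 * t\<^sup>2)" for x t
    using PU[of "- x - 4" t] that by (simp add: poly_calP_eq_P)
  have VU: "poly (poly_V m) x = poly (cheb_U (2*m)) t" if "x = 4 * t\<^sup>2 - 2" for x t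
    using PU[of "x - 2" t] that by (simp add: poly_V_eq_P)
  have dbl: "cos (2 * y) = 2 * (cos y)\<^sup>2 - 1" for y :: complex
    by (rule cos_double_cos)
  have P_prod: "poly (poly_P m) x = (\<Prod>k=1..m. x + 2 - of_real (2 * cos (2 * pi * real k / real (2*m+1))))" for x
    unfolding P(1) by (simp add: phi_cos_def algebra_simps)
  have Q_prod: "poly (poly_Q m) x = (\<Prod>k=1..m. x + 2 - of_real (2 * cos (pi * (2 * real k - 1) / real (2*m))))" for x
    unfolding Q(1) by (simp add: psi_cos_def algebra_simps)
  have V_prod: "poly (poly_V m) x = (\<Prod>k=1..m. x - of_real (2 * cos (2 * pi * real k / real (2*m+1))))" for x
    unfolding poly_V_eq_P P_prod by simp
  \<comment> \<open>The reflection x to - x - 4 turns each factor of P into its negative; the m signs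
    cancel the factor (-1)^m of the reflection formula.\<close>
  have calP_prod: "poly (poly_calP m) x = (\<Prod>k=1..m. x + 2 + of_real (2 * cos (2 * pi * real k / real (2*m+1))))" for x
  proof -
    have "poly (poly_calP m) x
        = (\<Prod>k=1..m. - 1) * (\<Prod>k=1..m. - x - 4 + 2 - of_real (2 * cos (2 * pi * real k / real (2*m+1))))"
      unfolding poly_calP_eq_P P_prod by simp
    also have "\<dots> = (\<Prod>k=1..m. x + 2 + of_real (2 * cos (2 * pi * real k / real (2*m+1))))"
      unfolding prod.distrib[symmetric] by (simp add: algebra_simps)
    finally show ?thesis .
  qed
  have P_fib: "s * poly (poly_P m) (s\<^sup>2) = poly (fib_poly (2*m+2)) s + poly (fib_poly (2*m)) s" for s
    using poly_fib_even[of m s] poly_fib_even[of n s]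
    by (simp add: m poly_P_Suc distrib_left del: fib_poly.simps)
  have P_lucas: "poly (lucas_poly (2*m+1)) s = s * poly (poly_P m) (s\<^sup>2)" for s
    using P_fib[of s] by (simp add: lucas_poly_eq_fib del: fib_poly.simps)
  have Q_fib: "poly (poly_Q m) (s\<^sup>2) = poly (fib_poly (2*m+1)) s + poly (fib_poly (2*m-1)) s" for s
    using poly_fib_odd[of m s] poly_fib_odd[of n s]
    by (simp add: m poly_Q_Suc del: fib_poly.simps)
  have Q_lucas: "poly (lucas_poly (2*m)) s = poly (poly_Q m) (s\<^sup>2)" for s
    using Q_fib[of s] by (simp add: m lucas_poly_eq_fib del: fib_poly.simps lucas_poly.simps)
  show ?thesis
  proof (intro conjI allI ballI impI)
    fix z assume "poly (poly_P m) z = 0"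
    then show "z \<in> \<real>" "order z (poly_P m) = 1" "Re z < 0" "Re z \<in> {-4..0}" using P(3) by auto
  next
    fix z assume "poly (poly_Q m) z = 0"
    then show "z \<in> \<real>" "order z (poly_Q m) = 1" "Re z < 0" "Re z \<in> {-4..0}" using Q(3) by auto
  next
    fix k assume "k \<in> {1..m}"
    then show "mu_root m k = of_real (phi_cos m k - 2)" unfolding mu_root_def by (rule P(2))
    then show "mu_root m k = of_real (2 * cos (2 * pi * real k / real (2*m+1)) - 2)"
      unfolding phi_cos_def .
  next
    fix k assume "k \<in> {1..m}"
    then show "nu_root m k = of_real (psi_cos m k - 2)" unfolding nu_root_def by (rule Q(2))
    then show "nu_root m k = of_real (2 * cos (pi * (2 * real k - 1) / real (2*m)) - 2)"
      unfolding psi_cos_def .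
  next
    fix x :: complex
    assume "x \<noteq> 0"
    then have nz: "csqrt x \<noteq> 0" by simp
    show "poly (poly_P m) x = 1 / csqrt x * poly (lucas_poly (2*m+1)) (csqrt x)"
      unfolding P_lucas using nz by simp
    show "poly (poly_P m) x =
        1 / csqrt x * (poly (fib_poly (2*m+2)) (csqrt x) + poly (fib_poly (2*m)) (csqrt x))"
      unfolding P_fib[symmetric] using nz by simp
    show "poly (poly_calQ m) x = 1 / csqrt x * poly (fib_poly (2*m+2)) (csqrt x)"
      unfolding poly_fib_even using nz by simp
  next
    fix x y :: complex
    show "poly (poly_P m) x = poly (cheb_U (2*m)) (csqrt (1 + x/4))"
      by (rule PU) simp
    show "poly (poly_P m) x = cheb_S (2*m) (csqrt (x + 4))"
      unfolding cheb_S_def by (rule PU) (simp add: power_divide add_divide_distrib)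
    show "poly (poly_P m) x = cheb_S (2*m) (2 * cos y)" if "x = 2 * cos (2*y) - 2"
      unfolding cheb_S_def by (rule PU) (simp add: that dbl)
    show "poly (poly_Q m) x = 2 * poly (cheb_T (2*m)) (csqrt (1 + x/4))"
      by (rule QT) simp
    show "poly (poly_Q m) x = cheb_C (2*m) (csqrt (x + 4))"
      unfolding cheb_C_def by (rule QT) (simp add: power_divide add_divide_distrib)
    show "poly (poly_Q m) x = cheb_C (2*m) (2 * cos y)" if "x = 2 * cos (2*y) - 2"
      unfolding cheb_C_def by (rule QT) (simp add: that dbl)
    show "poly (poly_Q m) x = poly (lucas_poly (2*m)) (csqrt x)"
      unfolding Q_lucas by simp
    show "poly (poly_Q m) x = poly (fib_poly (2*m+1)) (csqrt x) + poly (fib_poly (2*m-1)) (csqrt x)"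
      unfolding Q_fib[symmetric] by simp
    show "poly (poly_calP m) x = poly (fib_poly (2*m+1)) (csqrt x)"
      unfolding poly_fib_odd by simp
    show "poly (poly_calP m) x = (-1)^m * poly (cheb_U (2*m)) (csqrt (- x / 4))"
      by (rule calPU) simp
    show "poly (poly_calP m) x = (-1)^m * cheb_S (2*m) (csqrt (- x))"
      unfolding cheb_S_def by (rule calPU) (simp add: power_divide add_divide_distrib)
    show "poly (poly_calP m) x = (-1)^m * cheb_S (2*m) (2 * \<i> * cos y)" if "x = 2 * cos (2*y) + 2"
      unfolding cheb_S_def by (rule calPU) (simp add: that dbl power_mult_distrib)
    show "poly (poly_V m) x = poly (poly_P m) (x - 2)"
      by (rule poly_V_eq_P)
    show "poly (poly_V m) x = poly (cheb_U (2*m)) (csqrt ((1 + x/2) / 2))"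
      by (rule VU) (simp add: field_simps)
    show "poly (poly_V m) x = cheb_S (2*m) (csqrt (x + 2))"
      unfolding cheb_S_def by (rule VU) (simp add: power_divide add_divide_distrib)
    show "poly (poly_V m) x = cheb_S (2*m) (2 * cos y)" if "x = 2 * cos (2*y)"
      unfolding cheb_S_def by (rule VU) (simp add: that dbl)
  qed (rule P_prod Q_prod calP_prod V_prod)+
qed

end
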